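(* For any integer $m\ge 3$, every $m$-uniform special shift-chain is $2$-colorable. Moreover, such a coloring can be constructed in linear time.
   Context: For $A\subset[n]=\{1,2,\ldots,n\}$, denote by $a_i$ the $i$-th smallest element of $A$. For two sets $A,B\subset[n]$ of equal size, write $A\preceq B$ if $a_i\le b_i$ for every $i$. An $m$-uniform hypergraph (every hyperedge has exactly $m$ elements) on the vertex set $[n]$ is called a shift-chain if its hyperedges are totally ordered by the relation $\preceq$. A shift-chain $\mathcal{H}$ is special if for any two (distinct) hyperedges $A,B\in\mathcal{H}$ with $A\preceq B$, we have $\max(A\setminus B)<\min(B\setminus A)$. A hypergraph is $2$-colorable if its vertices can be colored with two colors so that no hyperedge is monochromatic. Linear time means that there is an algorithm whose running time is linear in the size of the input hypergraph (the number of vertices together with the explicit list of hyperedges). *)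

theory Defs
  imports Main
begin

section \<open>Special shift-chains\<close>

text \<open>
  Hyperedges are sets of natural numbers contained in \<open>{1..n}\<close>.  The \<open>i\<close>-th smallest
  element of a finite set is indexed from 0 here.
\<close>

definition shift_le :: "nat set \<Rightarrow> nat set \<Rightarrow> bool" where
  "shift_le A B \<longleftrightarrow> card A = card B \<and>
     (\<forall>i < card A. sorted_list_of_set A ! i \<le> sorted_list_of_set B ! i)"

definition uniform_hypergraph :: "nat \<Rightarrow> nat \<Rightarrow> nat set set \<Rightarrow> bool" where
  "uniform_hypergraph n m H \<longleftrightarrow> (\<forall>A\<in>H. A \<subseteq> {1..n} \<and> card A = m)"

text \<open>
  On finite sets of equal size \<^const>\<open>shift_le\<close> is always a partial order, so being totally
  ordered amounts to pairwise comparability.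
\<close>

definition shift_chain :: "nat \<Rightarrow> nat \<Rightarrow> nat set set \<Rightarrow> bool" where
  "shift_chain n m H \<longleftrightarrow> uniform_hypergraph n m H \<and>
     (\<forall>A\<in>H. \<forall>B\<in>H. shift_le A B \<or> shift_le B A)"

text \<open>
  Distinct hyperedges of a uniform hypergraph have nonempty differences in both directions, so
  \<open>Max\<close> and \<open>Min\<close> are only applied to nonempty finite sets.
\<close>

definition special_shift_chain :: "nat \<Rightarrow> nat \<Rightarrow> nat set set \<Rightarrow> bool" where
  "special_shift_chain n m H \<longleftrightarrow> shift_chain n m H \<and>
     (\<forall>A\<in>H. \<forall>B\<in>H. A \<noteq> B \<and> shift_le A B \<longrightarrow> Max (A - B) < Min (B - A))"

definition monochromatic :: "(nat \<Rightarrow> nat) \<Rightarrow> nat set \<Rightarrow> bool" where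
  "monochromatic f A \<longleftrightarrow> (\<forall>u\<in>A. \<forall>v\<in>A. f u = f v)"

definition proper_2_coloring :: "nat \<Rightarrow> nat set set \<Rightarrow> (nat \<Rightarrow> nat) \<Rightarrow> bool" where
  "proper_2_coloring n H f \<longleftrightarrow>
     (\<forall>v\<in>{1..n}. f v \<in> {0, 1}) \<and> (\<forall>A\<in>H. \<not> monochromatic f A)"

definition two_colorable :: "nat \<Rightarrow> nat set set \<Rightarrow> bool" where
  "two_colorable n H \<longleftrightarrow> (\<exists>f. proper_2_coloring n H f)"


section \<open>Running time\<close>

text \<open>
  The model of computation is the word RAM, programmed in a structured while language: finitely
  many scalar variables and finitely many arrays of words (a program text mentions only finitely
  many names), with constants, addition, truncated subtraction, indirect addressing and
  comparison.  A word holds a number below \<open>W\<close>.  A run in which some evaluated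
  subexpression is not below \<open>W\<close> is stuck, that is, it has no derivation.  Every node of an
  evaluated expression and every executed command costs one unit of time.
\<close>

datatype exp = Num nat | Var string | Elem string exp | Plus exp exp | Minus exp exp

datatype bexp = Less exp exp | Not bexp | And bexp bexp

datatype com =
    Skip
  | Assign string exp
  | Store string exp exp
  | Seq com com
  | If bexp com com
  | While bexp com

record state =
  scalar :: "string \<Rightarrow> nat"
  array :: "string \<Rightarrow> nat \<Rightarrow> nat"

fun eval :: "exp \<Rightarrow> state \<Rightarrow> nat" where
  "eval (Num k) s = k"
| "eval (Var x) s = scalar s x"
| "eval (Elem a e) s = array s a (eval e s)"
| "eval (Plus e1 e2) s = eval e1 s + eval e2 s"
| "eval (Minus e1 e2) s = eval e1 s - eval e2 s"

fun fits :: "nat \<Rightarrow> exp \<Rightarrow> state \<Rightarrow> bool" where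
  "fits W (Num k) s \<longleftrightarrow> k < W"
| "fits W (Var x) s \<longleftrightarrow> scalar s x < W"
| "fits W (Elem a e) s \<longleftrightarrow> fits W e s \<and> array s a (eval e s) < W"
| "fits W (Plus e1 e2) s \<longleftrightarrow> fits W e1 s \<and> fits W e2 s \<and> eval e1 s + eval e2 s < W"
| "fits W (Minus e1 e2) s \<longleftrightarrow> fits W e1 s \<and> fits W e2 s"

fun cost :: "exp \<Rightarrow> nat" where
  "cost (Num k) = 1"
| "cost (Var x) = 1"
| "cost (Elem a e) = 1 + cost e"
| "cost (Plus e1 e2) = 1 + cost e1 + cost e2"
| "cost (Minus e1 e2) = 1 + cost e1 + cost e2"

fun beval :: "bexp \<Rightarrow> state \<Rightarrow> bool" where
  "beval (Less e1 e2) s \<longleftrightarrow> eval e1 s < eval e2 s"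
| "beval (Not b) s \<longleftrightarrow> \<not> beval b s"
| "beval (And b1 b2) s \<longleftrightarrow> beval b1 s \<and> beval b2 s"

fun bfits :: "nat \<Rightarrow> bexp \<Rightarrow> state \<Rightarrow> bool" where
  "bfits W (Less e1 e2) s \<longleftrightarrow> fits W e1 s \<and> fits W e2 s"
| "bfits W (Not b) s \<longleftrightarrow> bfits W b s"
| "bfits W (And b1 b2) s \<longleftrightarrow> bfits W b1 s \<and> bfits W b2 s"

fun bcost :: "bexp \<Rightarrow> nat" where
  "bcost (Less e1 e2) = 1 + cost e1 + cost e2"
| "bcost (Not b) = 1 + bcost b"
| "bcost (And b1 b2) = 1 + bcost b1 + bcost b2"

text \<open>
  \<open>exec W c s t s'\<close>: with word bound \<open>W\<close>, the program \<open>c\<close> started in \<open>s\<close> halts in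
  \<open>s'\<close> after \<open>t\<close> units of time.
\<close>

inductive exec :: "nat \<Rightarrow> com \<Rightarrow> state \<Rightarrow> nat \<Rightarrow> state \<Rightarrow> bool" for W :: nat where
  Skip: "exec W Skip s 1 s"
| Assign: "fits W e s \<Longrightarrow>
    exec W (Assign x e) s (1 + cost e) (s\<lparr>scalar := (scalar s)(x := eval e s)\<rparr>)"
| Store: "fits W i s \<Longrightarrow> fits W e s \<Longrightarrow>
    exec W (Store a i e) s (1 + cost i + cost e)
      (s\<lparr>array := (array s)(a := (array s a)(eval i s := eval e s))\<rparr>)"
| Seq: "exec W c1 s t1 s1 \<Longrightarrow> exec W c2 s1 t2 s2 \<Longrightarrow> exec W (Seq c1 c2) s (1 + t1 + t2) s2"
| IfTrue: "bfits W b s \<Longrightarrow> beval b s \<Longrightarrow> exec W c1 s t s1 \<Longrightarrow>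
    exec W (If b c1 c2) s (1 + bcost b + t) s1"
| IfFalse: "bfits W b s \<Longrightarrow> \<not> beval b s \<Longrightarrow> exec W c2 s t s1 \<Longrightarrow>
    exec W (If b c1 c2) s (1 + bcost b + t) s1"
| WhileFalse: "bfits W b s \<Longrightarrow> \<not> beval b s \<Longrightarrow> exec W (While b c) s (1 + bcost b) s"
| WhileTrue: "bfits W b s \<Longrightarrow> beval b s \<Longrightarrow> exec W c s t1 s1 \<Longrightarrow>
    exec W (While b c) s1 t2 s2 \<Longrightarrow> exec W (While b c) s (1 + bcost b + t1 + t2) s2"

inductive_cases exec_SkipE: "exec W Skip s t s'"
inductive_cases exec_AssignE: "exec W (Assign x e) s t s'"
inductive_cases exec_StoreE: "exec W (Store a i e) s t s'"
inductive_cases exec_SeqE: "exec W (Seq c1 c2) s t s'"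
inductive_cases exec_IfE: "exec W (If b c1 c2) s t s'"
inductive_cases exec_WhileE: "exec W (While b c) s t s'"

lemma exec_deterministic:
  "exec W c s t s' \<Longrightarrow> exec W c s u s'' \<Longrightarrow> u = t \<and> s'' = s'"
proof (induction arbitrary: u s'' rule: exec.induct)
  case (Skip s)
  then show ?case by (auto elim: exec_SkipE)
next
  case (Assign e s x)
  from Assign.prems show ?case by (auto elim: exec_AssignE)
next
  case (Store i s e a)
  from Store.prems show ?case by (auto elim: exec_StoreE)
next
  case (Seq c1 s t1 s1 c2 t2 s2)
  from Seq.prems obtain u1 r1 u2 where
    "exec W c1 s u1 r1" "exec W c2 r1 u2 s''" "u = 1 + u1 + u2"
    by (auto elim: exec_SeqE)
  with Seq.IH show ?case by metis
next
  case (IfTrue b s c1 t s1 c2)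
  from IfTrue.prems IfTrue.hyps obtain v where "exec W c1 s v s''" "u = 1 + bcost b + v"
    by (auto elim: exec_IfE)
  with IfTrue.IH show ?case by metis
next
  case (IfFalse b s c2 t s1 c1)
  from IfFalse.prems IfFalse.hyps obtain v where "exec W c2 s v s''" "u = 1 + bcost b + v"
    by (auto elim: exec_IfE)
  with IfFalse.IH show ?case by metis
next
  case (WhileFalse b s c)
  from WhileFalse.prems WhileFalse.hyps show ?case by (auto elim: exec_WhileE)
next
  case (WhileTrue b s c t1 s1 t2 s2)
  from WhileTrue.prems WhileTrue.hyps obtain u1 r1 u2 where
    "exec W c s u1 r1" "exec W (While b c) r1 u2 s''" "u = 1 + bcost b + u1 + u2"
    by (auto elim: exec_WhileE)
  with WhileTrue.IH show ?case by metis
qed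

text \<open>
  An explicit list of the hyperedges: each hyperedge occurs exactly once, as a list of its
  elements without repetition.  Neither the hyperedges nor the elements of a hyperedge need to be
  listed in any particular order.
\<close>

definition lists_hypergraph :: "nat list list \<Rightarrow> nat set set \<Rightarrow> bool" where
  "lists_hypergraph es H \<longleftrightarrow>
     distinct (map set es) \<and> set (map set es) = H \<and> (\<forall>e\<in>set es. distinct e)"

definition hypergraph_size :: "nat \<Rightarrow> nat set set \<Rightarrow> nat" where
  "hypergraph_size n H = n + (\<Sum>A\<in>H. card A)"

text \<open>
  The array \<open>edges\<close> initially holds the concatenation of the lists of the hyperedges, from
  position 0 on; everything that is not part of the input is initially 0.
\<close>

definition input_state :: "nat \<Rightarrow> nat \<Rightarrow> nat list list \<Rightarrow> state" where
  "input_state n m es = \<lparr>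
     scalar = (\<lambda>x. 0)(''n'' := n, ''m'' := m, ''count'' := length es),
     array = (\<lambda>a i. 0)(''edges'' :=
       (\<lambda>i. if i < length (concat es) then concat es ! i else 0))\<rparr>"

definition output_coloring :: "state \<Rightarrow> nat \<Rightarrow> nat" where
  "output_coloring s v = array s ''color'' v"

text \<open>
  \<open>P\<close> finds proper 2-colorings of the \<open>m\<close>-uniform special shift-chains in time linear in the
  size \<open>N\<close> of the hypergraph, with the same program and constant for all \<open>m \<ge> m0\<close>, on words
  of \<open>O(log N)\<close> bits.  The offsets \<open>N + 1\<close> and \<open>N + 2\<close> only matter for degenerate inputs.
\<close>

definition colors_special_shift_chains_in_linear_time :: "com \<Rightarrow> nat \<Rightarrow> bool" where
  "colors_special_shift_chains_in_linear_time P m0 \<longleftrightarrow>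
     (\<exists>c. \<forall>m n H es. m \<ge> m0 \<longrightarrow> special_shift_chain n m H \<longrightarrow> lists_hypergraph es H \<longrightarrow>
        (\<exists>t s. exec ((hypergraph_size n H + 2) ^ c) P (input_state n m es) t s \<and>
               t \<le> c * (hypergraph_size n H + 1) \<and>
               proper_2_coloring n H (output_coloring s)))"

end

theory Submission
  imports Defs
begin

text \<open>
  Consider the three largest vertices \<open>a < b < c\<close> of each hyperedge. If the maximum \<open>w\<close> of a hyperedge
  \<open>F\<close> is smaller than the maximum \<open>c\<close> of \<open>E\<close>, then \<open>F - E\<close> lies entirely before \<open>E - F\<close>. When moreover
  \<open>b < w\<close>, this leaves only \<open>E - F = {c}\<close> and \<open>F - E = {w}\<close>, so the triple of \<open>F\<close> is \<open>a, b, w\<close>. Call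
  the triple \<open>a, b, c\<close> loose if such a maximum \<open>w\<close> exists. In loose triples \<open>b\<close> determines \<open>a\<close>
  (\<open>loose_unique\<close>), so it is possible to color the vertices from left to right as follows: the middle
  \<open>b\<close> of a loose triple gets the color opposite to that of \<open>a\<close>; any other maximum gets the color
  opposite to that of the preceding maximum; and all remaining vertices copy the color of the
  preceding maximum.

  A loose triple is not monochromatic because of \<open>a\<close> and \<open>b\<close>. In a triple that is not loose, \<open>b\<close>
  normally has the color of the maximum preceding \<open>c\<close>, and \<open>c\<close> has the opposite one. The exceptions,
  where \<open>b\<close> or \<open>c\<close> is the middle of some loose triple, are resolved by \<open>loose_middle_forces\<close> and by a
  second consequence of the separation of the differences; this is \<open>not_monochromatic\<close>. The step from
  hyperedges to triples is \<open>triple_chain_top_three\<close>.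

  The rule is an algorithm with four passes: find the three largest vertices of each hyperedge
  and mark the maxima; compute the preceding maximum of each vertex; record the first vertex of each
  loose triple at its middle vertex; color the vertices. Each pass takes constant time per vertex or
  per element of a hyperedge, none depends on the order in which the input is listed, and all
  words are bounded by the size of the input plus 1. Correctness and running time are established
  together, with weakest preconditions whose postconditions speak about time
  (\<open>wp_color_special_shift_chain\<close>). Since the program succeeds on every listing, a coloring exists.
\<close>

section \<open>Colouring a chain of triples\<close>

text \<open>
  The largest element of \<open>M\<close> below \<open>v\<close>, where 0 stands for the absence of such an element. The
  recursion is the one that a scan of the vertices from left to right carries out.
\<close>
primrec prev :: "nat set \<Rightarrow> nat \<Rightarrow> nat" where
  "prev M 0 = 0"
| "prev M (Suc v) = (if v \<in> M then v else prev M v)"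

lemma prev_le: "prev M v \<le> v"
  by (induction v) auto

lemma prev_less: "0 < v \<Longrightarrow> prev M v < v"
  using prev_le[of M "v - 1"] by (cases v) auto

lemma prev_mem: "prev M v \<noteq> 0 \<Longrightarrow> prev M v \<in> M"
  by (induction v) (auto split: if_splits)

lemma prev_ge: "w \<in> M \<Longrightarrow> w < v \<Longrightarrow> w \<le> prev M v"
  by (induction v) (auto simp: less_Suc_eq)

lemma prev_eqI:
  assumes "prev M c < v" "v \<le> c"
  shows "prev M v = prev M c"
proof (rule antisym)
  have "0 < v" using assms by simp
  show "prev M v \<le> prev M c"
    using prev_mem[of M v] prev_ge[of "prev M v" M c] prev_less[OF \<open>0 < v\<close>, of M] assms
    by (cases "prev M v = 0") auto
  show "prev M c \<le> prev M v"
    using prev_mem[of M c] prev_ge[of "prev M c" M v] assms by (cases "prev M c = 0") auto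
qed

text \<open>
  What the coloring needs to know about the triples formed by the three largest vertices of the
  hyperedges: a hyperedge whose maximum lies between the last two vertices of another one agrees
  with it apart from the maximum (\<open>link\<close>), and if the maximum \<open>c\<close> of one hyperedge is the second
  largest vertex of another, then the vertex \<open>x\<close> that precedes \<open>c\<close> in the latter is shared or lies
  between \<open>b\<close> and \<open>c\<close> (\<open>step\<close>).
\<close>
locale triple_chain =
  fixes T :: "nat \<Rightarrow> nat \<Rightarrow> nat \<Rightarrow> bool" and n :: nat
  assumes incr: "T a b c \<Longrightarrow> 0 < a \<and> a < b \<and> b < c \<and> c \<le> n"
    and link: "T x y z \<Longrightarrow> T x' y' w \<Longrightarrow> y < w \<Longrightarrow> w < z \<Longrightarrow> x' = x \<and> y' = y"
    and step: "T a b c \<Longrightarrow> T x c t \<Longrightarrow> x = a \<or> x = b \<or> b < x"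
begin

definition maxima :: "nat set" where
  "maxima = {c. \<exists>a b. T a b c}"

text \<open>
  Another maximum separates the last two vertices. By \<open>link\<close> such a triple belongs to a run of triples
  that all begin with \<open>a\<close> and \<open>b\<close>, so the pair \<open>a\<close>, \<open>b\<close> is the one to be colored differently: the
  last vertices of the run may be needed for other hyperedges.
\<close>
definition loose :: "nat \<Rightarrow> nat \<Rightarrow> nat \<Rightarrow> bool" where
  "loose a b c \<longleftrightarrow> T a b c \<and> b < prev maxima c"

lemma loose_between:
  assumes "loose x y z"
  obtains w where "T x y w" "y < w" "w < z"
proof -
  let ?w = "prev maxima z"
  have T: "T x y z" and w: "y < ?w" using assms by (auto simp: loose_def)
  have "?w < z" using prev_less incr[OF T] by simp
  moreover obtain x' y' where T': "T x' y' ?w"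
    using prev_mem[of maxima z] w by (auto simp: maxima_def)
  ultimately show thesis using that link[OF T T'] w by metis
qed

text \<open>
  Each of the two triples has a companion with the same first two vertices whose maximum is smaller.
  The smaller of these two maxima lies between \<open>y\<close> and the last vertex of the other triple, so \<open>link\<close>
  transfers the first vertex. This makes the first vertex a function of the second one.
\<close>
lemma loose_unique:
  assumes "loose x y z" "loose x' y z'"
  shows "x' = x"
proof -
  obtain w where w: "T x y w" "y < w" "w < z" using assms(1) by (rule loose_between)
  obtain w' where w': "T x' y w'" "y < w'" "w' < z'" using assms(2) by (rule loose_between)
  have T: "T x y z" "T x' y z'" using assms by (auto simp: loose_def)
  show ?thesis
  proof (cases "w < z'")
    case True
    then show ?thesis using link[OF T(2) w(1)] w by simp
  next
    case False
    then show ?thesis using link[OF T(1) w'(1)] w w' by simp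
  qed
qed

text \<open>
  If no maximum lies between \<open>v\<close> and \<open>c\<close>, then \<open>c\<close> is the first maximum after \<open>v\<close> and hence lies in the
  run of the loose triple, and \<open>link\<close> determines every triple that ends in \<open>c\<close>.
\<close>
lemma loose_middle_forces:
  assumes "loose x v t" "prev maxima c \<le> v" "v < c" "T a b c"
  shows "a = x \<and> b = v"
proof -
  let ?r = "prev maxima t"
  have T: "T x v t" and r: "v < ?r" using assms(1) by (auto simp: loose_def)
  have "?r \<in> maxima" using prev_mem r by simp
  then have "\<not> ?r < c" using prev_ge[of ?r maxima c] r assms(2) by linarith
  moreover have "?r < t" using prev_less incr[OF T] by simp
  ultimately show ?thesis using link[OF T assms(4)] assms(3) by simp
qed

text \<open>
  Let \<open>q\<close> be the last maximum before \<open>c\<close>. Vertices from \<open>q\<close> on and before \<open>c\<close> that are the middle of no loose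
  triple copy the color of \<open>q\<close>. So a triple without a forced difference between \<open>a\<close> and \<open>b\<close> has
  \<open>b\<close> colored like \<open>q\<close>, and \<open>c\<close> gets the other color, unless \<open>c\<close> itself is the middle of a loose triple
  and avoids the color of some \<open>x\<close> instead. By \<open>step\<close> that \<open>x\<close> is \<open>a\<close>, or \<open>b\<close>, or lies between \<open>b\<close>
  and \<open>c\<close>, and in the last case it has the color of \<open>q\<close> as well.
\<close>
lemma not_monochromatic:
  assumes mid: "\<And>x y t. loose x y t \<Longrightarrow> mid y = x"
    and loose_mid: "\<And>y. mid y \<noteq> 0 \<Longrightarrow> \<exists>t. loose (mid y) y t"
    and col: "\<And>v. 0 < v \<Longrightarrow> v \<le> n \<Longrightarrow> f v = (if mid v \<noteq> 0 then 1 - f (mid v)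
       else if v \<in> maxima then 1 - f (prev maxima v) else f (prev maxima v))"
    and two: "\<And>v. f v \<le> (1 :: nat)"
    and T: "T a b c"
  shows "f a \<noteq> f b \<or> f b \<noteq> f c"
proof -
  let ?q = "prev maxima c"
  have flip: "1 - f v \<noteq> f v" for v using two[of v] by presburger
  have abc: "0 < a" "a < b" "b < c" "c \<le> n" using incr[OF T] by auto
  \<comment> \<open>vertices that copy: no maximum lies between \<open>?q\<close> and \<open>c\<close>\<close>
  have near: "f v = f ?q" if v: "?q \<le> v" "v < c" "mid v = 0" for v
  proof (cases "v = ?q")
    case False
    then have "v \<notin> maxima" using prev_ge[of v maxima c] v by auto
    moreover have "prev maxima v = ?q" using prev_eqI[of maxima c v] False v by simp
    ultimately show ?thesis using col[of v] v False abc by simp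
  qed simp
  show ?thesis
  proof (cases "mid b = 0")
    case False
    then obtain t where t: "loose (mid b) b t" using loose_mid by blast
    \<comment> \<open>also when the triple is not loose but its middle is that of another, loose one\<close>
    have "mid b = a"
    proof (cases "b < ?q")
      case True
      then show ?thesis using mid T by (simp add: loose_def)
    next
      case False
      then show ?thesis using loose_middle_forces[OF t _ _ T] abc by simp
    qed
    then show ?thesis using col[of b] False flip[of a] abc by simp
  next
    case True
    then have "\<not> loose a b c" using mid abc by fastforce
    then have q: "?q \<le> b" using T by (simp add: loose_def)
    have fb: "f b = f ?q" using near q abc True by simp
    show ?thesis
    proof (cases "mid c = 0")
      case True
      moreover have "c \<in> maxima" using T by (auto simp: maxima_def)
      ultimately show ?thesis using col[of c] abc fb flip[of ?q] by simp
    next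
      case False
      then obtain t where t: "loose (mid c) c t" using loose_mid by blast
      let ?x = "mid c"
      have fc: "f c = 1 - f ?x" using col[of c] abc False by simp
      have xc: "?x < c" and Tx: "T ?x c t" using incr t by (auto simp: loose_def)
      consider "?x = a \<or> ?x = b" | "b < ?x" using step[OF T Tx] by blast
      then show ?thesis
      proof cases
        case 1
        then show ?thesis using fc flip by metis
      next
        case 2
        have "mid ?x = 0"
          using loose_mid[of ?x] loose_middle_forces[of _ ?x _ c a b] T q 2 xc by fastforce
        then have "f ?x = f b" using near[of ?x] q 2 xc fb by simp
        then show ?thesis using fc flip by metis
      qed
    qed
  qed
qed

end

section \<open>The three largest vertices of each hyperedge\<close>

text \<open>
  Zeros fill the places while \<open>S\<close> has fewer than three elements. In this form the predicate is
  preserved when the elements of a list are inserted one after the other.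
\<close>
definition top_three :: "nat set \<Rightarrow> nat \<Rightarrow> nat \<Rightarrow> nat \<Rightarrow> bool" where
  "top_three S x y z \<longleftrightarrow> x \<le> y \<and> y \<le> z \<and> (x = y \<longrightarrow> x = 0) \<and> (y = z \<longrightarrow> y = 0) \<and>
     {x, y, z} \<subseteq> insert 0 S \<and> (\<forall>u\<in>S. u = z \<or> u = y \<or> u \<le> x)"

lemma top_three_empty: "top_three {} 0 0 0"
  by (simp add: top_three_def)

lemma top_three_insert:
  assumes S: "top_three S x y z" and v: "v \<notin> S" "0 < v"
  shows "z < v \<Longrightarrow> top_three (insert v S) y z v"
    and "\<not> z < v \<Longrightarrow> y < v \<Longrightarrow> top_three (insert v S) y v z"
    and "\<not> y < v \<Longrightarrow> x < v \<Longrightarrow> top_three (insert v S) v y z"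
    and "\<not> x < v \<Longrightarrow> top_three (insert v S) x y z"
proof -
  have new: "v \<noteq> x" "v \<noteq> y" "v \<noteq> z" using S v by (auto simp: top_three_def)
  show "z < v \<Longrightarrow> top_three (insert v S) y z v"
    using S v new by (auto simp: top_three_def)
  show "\<not> z < v \<Longrightarrow> y < v \<Longrightarrow> top_three (insert v S) y v z"
    using S v new by (auto simp: top_three_def)
  show "\<not> y < v \<Longrightarrow> x < v \<Longrightarrow> top_three (insert v S) v y z"
    using S v new by (auto simp: top_three_def)
  show "\<not> x < v \<Longrightarrow> top_three (insert v S) x y z"
    using S v new by (auto simp: top_three_def)
qed

lemma top_three_proper:
  assumes "top_three S x y z" "finite S" "3 \<le> card S" "0 \<notin> S"
  shows "0 < x" "x < y" "y < z" "{x, y, z} \<subseteq> S" "\<And>u. u \<in> S \<Longrightarrow> u = z \<or> u = y \<or> u \<le> x"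
proof -
  show pos: "0 < x"
  proof (rule ccontr)
    assume "\<not> 0 < x"
    then have "S \<subseteq> {y, z}" using assms by (auto simp: top_three_def)
    then have "card S \<le> card {y, z}" by (rule card_mono[rotated]) simp
    then show False using assms(3) card_insert_le_m1[of 2 "{z}" y] by (simp add: card_insert_if split: if_splits)
  qed
  show "x < y" "y < z" "{x, y, z} \<subseteq> S" "\<And>u. u \<in> S \<Longrightarrow> u = z \<or> u = y \<or> u \<le> x"
    using pos assms by (auto simp: top_three_def)
qed

lemma shift_le_Max:
  assumes "shift_le A B" "finite A" "finite B" "A \<noteq> {}"
  shows "Max A \<le> Max B"
proof -
  have last: "sorted_list_of_set C ! (card C - 1) = Max C" if "finite C" "C \<noteq> {}" for C :: "nat set"
  proof -
    let ?l = "sorted_list_of_set C"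
    have len: "length ?l = card C" and "card C > 0" using that by (auto simp: card_gt_0_iff)
    show ?thesis
    proof (rule Max_eqI[symmetric])
      show "finite C" by fact
      show "?l ! (card C - 1) \<in> C"
        using nth_mem[of "card C - 1" ?l] len \<open>card C > 0\<close> that by simp
      fix y assume "y \<in> C"
      then have "y \<in> set ?l" using that by simp
      then obtain i where "i < card C" "y = ?l ! i" unfolding in_set_conv_nth len by blast
      then show "y \<le> ?l ! (card C - 1)"
        using sorted_nth_mono[of ?l i "card C - 1"] len by simp
    qed
  qed
  have "card A = card B" "card A > 0" using assms by (auto simp: shift_le_def card_gt_0_iff)
  moreover then have "B \<noteq> {}" by auto
  moreover have "sorted_list_of_set A ! (card A - 1) \<le> sorted_list_of_set B ! (card A - 1)"
    using assms(1) \<open>card A > 0\<close> by (auto simp: shift_le_def)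
  ultimately show ?thesis using last[of A] last[of B] assms by simp
qed

text \<open>
  The maxima decide the direction in which the two hyperedges are comparable, which gives the
  defining property of special shift-chains without reference to the order.
\<close>
lemma special_shift_chain_separated:
  assumes H: "special_shift_chain n m H" "A \<in> H" "B \<in> H"
    and lt: "Max A < Max B" and "f \<in> A - B" "g \<in> B - A"
  shows "f < g"
proof -
  have "A \<subseteq> {1..n}" "B \<subseteq> {1..n}"
    using H unfolding special_shift_chain_def shift_chain_def uniform_hypergraph_def by blast+
  then have fin: "finite A" "finite B" by (auto intro: finite_subset)
  have "\<not> shift_le B A" using shift_le_Max[of B A] fin lt \<open>g \<in> B - A\<close> by fastforce
  moreover have "shift_le A B \<or> shift_le B A"
    using H unfolding special_shift_chain_def shift_chain_def by blast
  moreover have "A \<noteq> B" using lt by auto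
  ultimately have "Max (A - B) < Min (B - A)"
    using H unfolding special_shift_chain_def by blast
  moreover have "f \<le> Max (A - B)" "Min (B - A) \<le> g" using assms fin by auto
  ultimately show ?thesis by simp
qed

text \<open>
  For \<open>link\<close>, let \<open>E\<close> have the vertices \<open>x\<close>, \<open>y\<close>, \<open>z\<close> and let \<open>F\<close> have the maximum \<open>w\<close>. Then \<open>w\<close> belongs to
  \<open>F - E\<close>, so \<open>E - F\<close> lies beyond \<open>w\<close> and can only be \<open>{z}\<close>; as the sizes agree, \<open>F\<close> arises from \<open>E\<close>
  by replacing \<open>z\<close> with \<open>w\<close>. For \<open>step\<close>, if \<open>x\<close> were less than \<open>b\<close> and different from \<open>a\<close>, then
  \<open>b\<close> would be in \<open>F - E\<close>, so again the differences would be \<open>{b}\<close> and \<open>{t}\<close>; but then \<open>x\<close> would be in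
  \<open>F\<close>, below \<open>a\<close>, and \<open>a\<close> would be a second element of \<open>F - E\<close>.
\<close>
lemma triple_chain_top_three:
  assumes H: "special_shift_chain n m H" and m: "3 \<le> m"
  shows "triple_chain (\<lambda>a b c. \<exists>A\<in>H. top_three A a b c) n"
proof -
  have A: "A \<subseteq> {1..n}" "card A = m" "finite A" "0 \<notin> A" if "A \<in> H" for A
  proof -
    show "A \<subseteq> {1..n}" "card A = m"
      using H that unfolding special_shift_chain_def shift_chain_def uniform_hypergraph_def
      by blast+
    then show "finite A" "0 \<notin> A" using finite_subset[of A "{1..n}"] by auto
  qed
  have top: "0 < a" "a < b" "b < c" "{a, b, c} \<subseteq> A" "\<And>u. u \<in> A \<Longrightarrow> u = c \<or> u = b \<or> u \<le> a"
    if "A \<in> H" "top_three A a b c" for A a b c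
  proof -
    have "3 \<le> card A" using A(2)[OF that(1)] m by simp
    note t = top_three_proper[OF that(2) A(3)[OF that(1)] this A(4)[OF that(1)]]
    show "0 < a" "a < b" "b < c" "{a, b, c} \<subseteq> A" using t(1-4) .
    show "u = c \<or> u = b \<or> u \<le> a" if "u \<in> A" for u using t(5)[OF that] .
  qed
  have Max: "Max A = c" if "A \<in> H" "top_three A a b c" for A a b c
  proof (rule Max_eqI)
    note t = top[OF that]
    show "finite A" "c \<in> A" using A(3)[OF that(1)] t(4) by auto
    show "u \<le> c" if "u \<in> A" for u using t(2,3) t(5)[OF that] by auto
  qed
  have sep: "f < g" if "F \<in> H" "E \<in> H" "top_three F a b c" "top_three E x y z" "c < z"
    "f \<in> F - E" "g \<in> E - F" for F E a b c x y z f g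
    using special_shift_chain_separated[OF H, of F E f g] Max that by blast
  have diff: "card (F - E) = card (E - F)" if "F \<in> H" "E \<in> H" for E F
    using A(2,3)[OF that(1)] A(2,3)[OF that(2)]
      card_Diff_subset_Int[of F E] card_Diff_subset_Int[of E F] by (simp add: Int_commute)
  show ?thesis
  proof
    fix a b c assume "\<exists>A\<in>H. top_three A a b c"
    then obtain A' where "A' \<in> H" "top_three A' a b c" by blast
    then show "0 < a \<and> a < b \<and> b < c \<and> c \<le> n" using top(1-4)[of A' a b c] A(1)[of A'] by auto
  next
    fix x y z x' y' w
    assume "\<exists>A\<in>H. top_three A x y z" "\<exists>A\<in>H. top_three A x' y' w" and w: "y < w" "w < z"
    then obtain E F where E: "E \<in> H" "top_three E x y z" and F: "F \<in> H" "top_three F x' y' w"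
      by blast
    note tE = top[OF E] and tF = top[OF F]
    have wE: "w \<in> F - E" using tF(4) tE(2) tE(5)[of w] w by auto
    have "e = z" if "e \<in> E - F" for e
      using sep[OF F(1) E(1) F(2) E(2) w(2) wE that] tE(5)[of e] tE(2) w that by auto
    moreover have "z \<in> E - F" using tE(4) tF(5)[of z] tF(2,3) w by auto
    ultimately have EF: "E - F = {z}" by blast
    then have "card (F - E) = 1" using diff[OF F(1) E(1)] by simp
    then have FE: "F - E = {w}" using wE by (metis card_1_singletonE singletonD)
    have in_F: "u \<in> F" if "u \<in> E" "u \<noteq> z" for u using EF that by blast
    have in_E: "u \<in> E" if "u \<in> F" "u \<noteq> w" for u using FE that by blast
    have "x \<in> F" "y \<in> F" using in_F tE(2-4) by auto
    have "y' \<in> E" "x' \<in> E" using in_E tF(2-4) by auto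
    have "y' = y" using tF(5)[OF \<open>y \<in> F\<close>] tE(5)[OF \<open>y' \<in> E\<close>] tE(2,3) tF(2,3) w by auto
    moreover have "x' = x" using tF(5)[OF \<open>x \<in> F\<close>] tE(5)[OF \<open>x' \<in> E\<close>] tE(2,3) tF(2,3) w calculation by auto
    ultimately show "x' = x \<and> y' = y" by simp
  next
    fix a b c x t
    assume "\<exists>A\<in>H. top_three A a b c" "\<exists>A\<in>H. top_three A x c t"
    then obtain E F where F: "F \<in> H" "top_three F a b c" and E: "E \<in> H" "top_three E x c t"
      by blast
    note tE = top[OF E] and tF = top[OF F]
    show "x = a \<or> x = b \<or> b < x"
    proof (rule ccontr)
      assume "\<not> ?thesis"
      then have x: "x \<noteq> a" "x < b" by auto
      then have b: "b \<in> F - E" using tF(2-4) tE(5)[of b] tE(3) by auto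
      have "g = t" if "g \<in> E - F" for g
        using sep[OF F(1) E(1) F(2) E(2) tE(3) b that] tE(5)[of g] tF(4) x that by auto
      then have EF: "E - F \<subseteq> {t}" by blast
      then have "card (E - F) \<le> 1" using card_mono[of "{t}" "E - F"] by simp
      then have "card (F - E) \<le> 1" using diff[OF F(1) E(1)] by simp
      then have FE: "F - E = {b}"
        using b A(3)[OF F(1)] by (auto simp: card_le_Suc0_iff_eq)
      have "x \<in> F" using EF tE(2-4) by fastforce
      then have "x < a" using tF(5)[of x] x tE(2) by auto
      then have "a \<notin> E" using tE(3) tF(2,3) tE(5)[of a] by auto
      then show False using FE tF(2,4) by auto
    qed
  qed
qed

section \<open>Weakest preconditions with running time\<close>

text \<open>
  The postcondition receives the exact running time, so that the equations below turn the
  execution of loop-free code, including its cost, into simplification.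
\<close>
definition wp :: "nat \<Rightarrow> com \<Rightarrow> (nat \<Rightarrow> state \<Rightarrow> bool) \<Rightarrow> state \<Rightarrow> bool" where
  "wp W c Q s \<longleftrightarrow> (\<exists>t s'. exec W c s t s' \<and> Q t s')"

lemma wp_Skip [simp]: "wp W Skip Q s \<longleftrightarrow> Q 1 s" (is "?L \<longleftrightarrow> ?R")
proof
  assume ?L
  then show ?R by (auto simp: wp_def elim!: exec_SkipE)
next
  assume ?R
  then show ?L unfolding wp_def by (blast intro: exec.Skip)
qed

lemma wp_Assign [simp]:
  "wp W (Assign x e) Q s \<longleftrightarrow>
     fits W e s \<and> Q (1 + cost e) (s\<lparr>scalar := (scalar s)(x := eval e s)\<rparr>)" (is "?L \<longleftrightarrow> ?R")
proof
  assume ?L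
  then show ?R by (auto simp: wp_def elim!: exec_AssignE)
next
  assume ?R
  then show ?L unfolding wp_def by (blast intro: exec.Assign)
qed

lemma wp_Store [simp]:
  "wp W (Store a i e) Q s \<longleftrightarrow> fits W i s \<and> fits W e s \<and>
     Q (1 + cost i + cost e) (s\<lparr>array := (array s)(a := (array s a)(eval i s := eval e s))\<rparr>)" (is "?L \<longleftrightarrow> ?R")
proof
  assume ?L
  then show ?R by (auto simp: wp_def elim!: exec_StoreE)
next
  assume ?R
  then show ?L unfolding wp_def by (blast intro: exec.Store)
qed

lemma wp_Seq [simp]:
  "wp W (Seq c1 c2) Q s \<longleftrightarrow> wp W c1 (\<lambda>t1. wp W c2 (\<lambda>t2. Q (1 + t1 + t2))) s" (is "?L \<longleftrightarrow> ?R")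
proof
  assume ?L
  then show ?R by (auto simp: wp_def elim!: exec_SeqE)
next
  assume ?R
  then show ?L unfolding wp_def by (blast intro: exec.Seq)
qed

lemma wp_If [simp]:
  "wp W (If b c1 c2) Q s \<longleftrightarrow> bfits W b s \<and>
     (beval b s \<longrightarrow> wp W c1 (\<lambda>t. Q (1 + bcost b + t)) s) \<and>
     (\<not> beval b s \<longrightarrow> wp W c2 (\<lambda>t. Q (1 + bcost b + t)) s)" (is "?L \<longleftrightarrow> ?R")
proof
  assume ?L
  then show ?R by (auto simp: wp_def elim!: exec_IfE)
next
  assume ?R
  then show ?L unfolding wp_def by (blast intro: exec.IfTrue exec.IfFalse)
qed

text \<open>
  A loop that makes exactly \<open>k\<close> rounds, each within time \<open>T\<close>. The invariant is indexed by the
  number of completed rounds, so that it serves as termination measure as well.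
\<close>
lemma wp_While:
  assumes start: "I 0 s"
    and body: "\<And>i s. i < k \<Longrightarrow> I i s \<Longrightarrow>
      bfits W b s \<and> beval b s \<and> wp W c (\<lambda>t s'. t \<le> T \<and> I (Suc i) s') s"
    and stop: "\<And>s. I k s \<Longrightarrow> bfits W b s \<and> \<not> beval b s"
    and post: "\<And>t s'. t \<le> k * (1 + bcost b + T) + (1 + bcost b) \<Longrightarrow> I k s' \<Longrightarrow> Q t s'"
  shows "wp W (While b c) Q s"
proof -
  have "\<exists>t s'. exec W (While b c) s t s' \<and>
      t \<le> d * (1 + bcost b + T) + (1 + bcost b) \<and> I k s'"
    if "d \<le> k" "I (k - d) s" for d s
    using that
  proof (induction d arbitrary: s)
    case 0
    then have "bfits W b s" "\<not> beval b s" using stop[of s] by simp_all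
    then have "exec W (While b c) s (1 + bcost b) s" by (rule WhileFalse)
    with 0 show ?case by auto
  next
    case (Suc d)
    have "k - Suc d < k" "Suc (k - Suc d) = k - d" using Suc.prems by auto
    with body[of "k - Suc d" s] Suc.prems(2) obtain t1 s1
      where b: "bfits W b s" "beval b s" and c: "exec W c s t1 s1" "t1 \<le> T" "I (k - d) s1"
      unfolding wp_def by auto
    obtain t2 s2 where w: "exec W (While b c) s1 t2 s2"
      "t2 \<le> d * (1 + bcost b + T) + (1 + bcost b)" "I k s2"
      using Suc.IH[OF _ c(3)] Suc.prems(1) by auto
    have "exec W (While b c) s (1 + bcost b + t1 + t2) s2" using b c(1) w(1) by (rule WhileTrue)
    moreover have "1 + bcost b + t1 + t2 \<le> Suc d * (1 + bcost b + T) + (1 + bcost b)"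
      using c(2) w(2) by simp
    ultimately show ?case using w(3) by blast
  qed
  from this[of k s] start post show ?thesis unfolding wp_def by auto
qed

primrec block :: "com list \<Rightarrow> com" where
  "block [] = Skip"
| "block (c # cs) = Seq c (block cs)"

section \<open>The program\<close>

text \<open>
  The next hyperedge starts at position \<open>p\<close> of the input. Its three largest vertices are collected
  in \<open>x\<close>, \<open>y\<close>, \<open>z\<close>, whatever the order of the list.
\<close>
definition read_edge :: com where
  "read_edge = block [
     Assign ''x'' (Num 0), Assign ''y'' (Num 0), Assign ''z'' (Num 0), Assign ''j'' (Num 0),
     While (Less (Var ''j'') (Var ''m'')) (block [
       Assign ''v'' (Elem ''edges'' (Var ''p'')),
       If (Less (Var ''z'') (Var ''v''))
         (block [Assign ''x'' (Var ''y''), Assign ''y'' (Var ''z''), Assign ''z'' (Var ''v'')])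
         (If (Less (Var ''y'') (Var ''v''))
           (block [Assign ''x'' (Var ''y''), Assign ''y'' (Var ''v'')])
           (If (Less (Var ''x'') (Var ''v'')) (Assign ''x'' (Var ''v'')) Skip)),
       Assign ''p'' (Plus (Var ''p'') (Num 1)),
       Assign ''j'' (Plus (Var ''j'') (Num 1))])]"

definition record_edge :: com where
  "record_edge = block [
     read_edge,
     Store ''X'' (Var ''k'') (Var ''x''),
     Store ''Y'' (Var ''k'') (Var ''y''),
     Store ''Z'' (Var ''k'') (Var ''z''),
     Store ''max'' (Var ''z'') (Num 1),
     Assign ''k'' (Plus (Var ''k'') (Num 1))]"

definition read_edges :: com where
  "read_edges = block [
     Assign ''k'' (Num 0), Assign ''p'' (Num 0),
     While (Less (Var ''k'') (Var ''count'')) record_edge]"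

definition store_prev :: com where
  "store_prev = block [
     Assign ''v'' (Plus (Var ''v'') (Num 1)),
     Store ''prev'' (Var ''v'') (Var ''q''),
     If (Less (Num 0) (Elem ''max'' (Var ''v''))) (Assign ''q'' (Var ''v'')) Skip]"

definition find_prev :: com where
  "find_prev = block [
     Assign ''v'' (Num 0), Assign ''q'' (Num 0),
     While (Less (Var ''v'') (Var ''n'')) store_prev]"

text \<open>
  The condition says that the triple is loose; a nonzero \<open>mid\<close> value is the vertex whose color has
  to be avoided. Different triples with the same middle vertex write the same value, so the order
  of the hyperedges does not matter.
\<close>
definition mark_middle :: com where
  "mark_middle = block [
     If (Less (Elem ''Y'' (Var ''k'')) (Elem ''prev'' (Elem ''Z'' (Var ''k''))))
       (Store ''mid'' (Elem ''Y'' (Var ''k'')) (Elem ''X'' (Var ''k''))) Skip,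
     Assign ''k'' (Plus (Var ''k'') (Num 1))]"

definition mark_middles :: com where
  "mark_middles = block [
     Assign ''k'' (Num 0),
     While (Less (Var ''k'') (Var ''count'')) mark_middle]"

text \<open>
  For a vertex without preceding maximum the color is read from position 0, which acts as an
  additional vertex of color 0.
\<close>
definition paint_vertex :: com where
  "paint_vertex = block [
     Assign ''v'' (Plus (Var ''v'') (Num 1)),
     If (Less (Num 0) (Elem ''mid'' (Var ''v'')))
       (Store ''color'' (Var ''v'') (Minus (Num 1) (Elem ''color'' (Elem ''mid'' (Var ''v'')))))
       (If (Less (Num 0) (Elem ''max'' (Var ''v'')))
         (Store ''color'' (Var ''v'') (Minus (Num 1) (Elem ''color'' (Elem ''prev'' (Var ''v'')))))
         (Store ''color'' (Var ''v'') (Elem ''color'' (Elem ''prev'' (Var ''v'')))))]"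

definition paint :: com where
  "paint = block [
     Assign ''v'' (Num 0),
     While (Less (Var ''v'') (Var ''n'')) paint_vertex]"

definition color_special_shift_chain :: com where
  "color_special_shift_chain = block [read_edges, find_prev, mark_middles, paint]"

definition sizes :: "nat \<Rightarrow> nat \<Rightarrow> nat \<Rightarrow> state \<Rightarrow> bool" where
  "sizes n m k s \<longleftrightarrow> scalar s ''n'' = n \<and> scalar s ''m'' = m \<and> scalar s ''count'' = k"

lemma take_insert:
  assumes "distinct e" "j < length e"
  shows "set (take (Suc j) e) = insert (e ! j) (set (take j e))" "e ! j \<notin> set (take j e)"
  using assms by (auto simp: take_Suc_conv_app_nth in_set_conv_nth nth_eq_iff_index_eq)

lemma wp_read_edge:
  assumes e: "distinct e" "\<And>u. u \<in> set e \<Longrightarrow> 0 < u \<and> u < W"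
    and m: "scalar s ''m'' = length e"
    and edges: "\<And>j. j < length e \<Longrightarrow> array s ''edges'' (scalar s ''p'' + j) = e ! j"
    and W: "scalar s ''p'' + length e < W" "1 < W"
    and Q: "\<And>t s'. t \<le> 100 * length e + 100 \<Longrightarrow> array s' = array s \<Longrightarrow>
      scalar s' ''n'' = scalar s ''n'' \<Longrightarrow> scalar s' ''m'' = scalar s ''m'' \<Longrightarrow>
      scalar s' ''count'' = scalar s ''count'' \<Longrightarrow> scalar s' ''k'' = scalar s ''k'' \<Longrightarrow>
      scalar s' ''p'' = scalar s ''p'' + length e \<Longrightarrow>
      top_three (set e) (scalar s' ''x'') (scalar s' ''y'') (scalar s' ''z'') \<Longrightarrow> Q t s'"
  shows "wp W read_edge Q s"
proof -
  define I where "I j s' \<longleftrightarrow> array s' = array s \<and>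
      scalar s' ''n'' = scalar s ''n'' \<and> scalar s' ''m'' = scalar s ''m'' \<and>
      scalar s' ''count'' = scalar s ''count'' \<and> scalar s' ''k'' = scalar s ''k'' \<and>
      scalar s' ''j'' = j \<and> scalar s' ''p'' = scalar s ''p'' + j \<and>
      top_three (set (take j e)) (scalar s' ''x'') (scalar s' ''y'') (scalar s' ''z'')"
    for j and s' :: state
  have small: "x < W \<and> y < W \<and> z < W" if "top_three (set (take j e)) x y z" for j x y z
    using that e(2) W(2) set_take_subset[of j e] unfolding top_three_def by fastforce
  show ?thesis
    unfolding read_edge_def
    using W(2)
    apply simp
    apply (rule wp_While[where I = I and k = "length e" and T = 60])
       apply (simp add: I_def top_three_empty)
    subgoal for i r
      using small[of i "scalar r ''x''" "scalar r ''y''" "scalar r ''z''"] edges[of i]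
        e(2)[of "e ! i"] W m take_insert[OF e(1), of i]
        top_three_insert[of "set (take i e)" "scalar r ''x''" "scalar r ''y''" "scalar r ''z''" "e ! i"]
      by (simp add: I_def)
    subgoal using m W by (simp add: I_def)
    subgoal using m by (simp add: I_def Q)
    done
qed

section \<open>Loops of the program\<close>

text \<open>
  The lists of the hyperedges all have length \<open>m\<close>, so a running position finds hyperedge \<open>k\<close> at
  offset \<open>k * m\<close>.
\<close>
lemma concat_nth_uniform:
  assumes "\<And>e. e \<in> set es \<Longrightarrow> length e = m" "k < length es" "j < m"
  shows "concat es ! (k * m + j) = es ! k ! j"
  using assms
proof (induction es arbitrary: k)
  case (Cons e es)
  have "length e = m" using Cons.prems by simp
  then show ?case using Cons by (cases k) (auto simp: nth_append)
qed simp

lemma length_concat_uniform: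
  "(\<And>e. e \<in> set es \<Longrightarrow> length e = m) \<Longrightarrow> length (concat es) = length es * m"
  by (induction es) auto

text \<open>
  Without hyperedges \<open>m\<close> may exceed the word bound; it is evaluated only inside the loop over the
  hyperedges.
\<close>
lemma wp_read_edges:
  assumes es: "\<And>e. e \<in> set es \<Longrightarrow> distinct e \<and> length e = m \<and> 3 \<le> m \<and> set e \<subseteq> {1..n}"
    and W: "n + 2 \<le> W" "length es * m + 2 \<le> W"
    and Q: "\<And>t s. t \<le> length es * (100 * m + 200) + 20 \<Longrightarrow> sizes n m (length es) s \<Longrightarrow>
      (\<forall>i<length es. top_three (set (es ! i)) (array s ''X'' i) (array s ''Y'' i) (array s ''Z'' i)) \<Longrightarrow>
      array s ''max'' = (\<lambda>v. if v \<in> array s ''Z'' ` {..<length es} then 1 else 0) \<Longrightarrow>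
      array s ''mid'' = (\<lambda>v. 0) \<Longrightarrow> array s ''color'' = (\<lambda>v. 0) \<Longrightarrow> Q t s"
  shows "wp W read_edges Q (input_state n m es)"
proof -
  let ?l = "length es"
  define I where "I k s \<longleftrightarrow> sizes n m ?l s \<and>
      array s ''edges'' = array (input_state n m es) ''edges'' \<and>
      scalar s ''k'' = k \<and> scalar s ''p'' = k * m \<and>
      (\<forall>i<k. top_three (set (es ! i)) (array s ''X'' i) (array s ''Y'' i) (array s ''Z'' i)) \<and>
      array s ''max'' = (\<lambda>v. if v \<in> array s ''Z'' ` {..<k} then 1 else 0) \<and>
      array s ''mid'' = (\<lambda>v. 0) \<and> array s ''color'' = (\<lambda>v. 0)" for k and s :: state
  have edges: "array (input_state n m es) ''edges'' (k * m + j) = es ! k ! j"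
    if "k < ?l" "j < m" for k j
  proof -
    have "k * m + j < Suc k * m" using that by simp
    also have "\<dots> \<le> ?l * m" using that by (intro mult_le_mono1) simp
    finally show ?thesis
      using that es concat_nth_uniform[of es m k j] length_concat_uniform[of es m]
      by (simp add: input_state_def)
  qed
  have body: "wp W record_edge (\<lambda>t s'. t \<le> 100 * m + 196 \<and> I (Suc k) s') s \<and> k < W \<and> ?l < W"
    if k: "k < ?l" and I: "I k s" for k s
  proof -
    have "es ! k \<in> set es" using k by simp
    note e = es[OF this]
    have "Suc k * m \<le> ?l * m" using k by (intro mult_le_mono1) simp
    then have km: "k * m + m + 2 \<le> W" using W by simp
    have "k * 1 \<le> k * m" using e by (intro mult_le_mono2) simp
    then have kW: "k + 2 < W" using km e by linarith
    have "?l * 1 \<le> ?l * m" using e by (intro mult_le_mono2) simp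
    then have lW: "?l < W" using W(2) by linarith
    have small: "x < W \<and> y < W \<and> z < W" if "top_three (set (es ! k)) x y z" for x y z
    proof -
      have "{x, y, z} \<subseteq> {0..n}" using that e unfolding top_three_def by fastforce
      then show ?thesis using W(1) by simp
    qed
    \<comment> \<open>form in which the simplifier meets the image of the updated array \<open>Z\<close>\<close>
    have below: "{..<Suc k} \<inter> {i. i \<noteq> k} = {..<k}" by auto
    have "wp W record_edge (\<lambda>t s'. t \<le> 100 * m + 196 \<and> I (Suc k) s') s"
      unfolding record_edge_def block.simps
      apply (rule wp_Seq[THEN iffD2])
    proof (rule wp_read_edge[of "es ! k"])
      show "distinct (es ! k)" using e by simp
      show "0 < u \<and> u < W" if "u \<in> set (es ! k)" for u
      proof -
        have "u \<in> {1..n}" using that e by blast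
        then show ?thesis using W(1) by simp
      qed
      show "scalar s ''m'' = length (es ! k)" using I e by (simp add: I_def sizes_def)
      show "array s ''edges'' (scalar s ''p'' + j) = es ! k ! j" if "j < length (es ! k)" for j
        using that I e edges[OF k] by (simp add: I_def)
      show "scalar s ''p'' + length (es ! k) < W" "1 < W" using I e km by (simp_all add: I_def)
    next
      fix t and s' :: state
      assume "t \<le> 100 * length (es ! k) + 100" "array s' = array s"
        "scalar s' ''n'' = scalar s ''n''" "scalar s' ''m'' = scalar s ''m''"
        "scalar s' ''count'' = scalar s ''count''" "scalar s' ''k'' = scalar s ''k''"
        "scalar s' ''p'' = scalar s ''p'' + length (es ! k)"
        and top: "top_three (set (es ! k)) (scalar s' ''x'') (scalar s' ''y'') (scalar s' ''z'')"
      then show "wp W (Seq (Store ''X'' (Var ''k'') (Var ''x'')) (Seq (Store ''Y'' (Var ''k'') (Var ''y''))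
        (Seq (Store ''Z'' (Var ''k'') (Var ''z'')) (Seq (Store ''max'' (Var ''z'') (Num 1))
        (Seq (Assign ''k'' (Plus (Var ''k'') (Num 1))) Skip)))))
        (\<lambda>t2 s'. 1 + t + t2 \<le> 100 * m + 196 \<and> I (Suc k) s') s'"
        using I e kW small[OF top] below
        by (simp add: I_def sizes_def less_Suc_eq fun_eq_iff)
    qed
    then show ?thesis using kW lW by simp
  qed
  have vars: "scalar s ''k'' = k \<and> scalar s ''count'' = ?l" if "I k s" for k s
    using that by (simp add: I_def sizes_def)
  have lW: "?l < W"
  proof (cases es)
    case (Cons e es')
    then have "?l * 1 \<le> ?l * m" using es[of e] by (intro mult_le_mono2) simp
    then show ?thesis using W(2) by linarith
  qed (use W in simp)
  show ?thesis
    unfolding read_edges_def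
    using W(1)
    apply simp
    apply (rule wp_While[where I = I and k = ?l and T = "100 * m + 196"])
    subgoal by (simp add: I_def sizes_def input_state_def)
    subgoal for k s using body[of k s] vars[of k s] by simp
    subgoal using lW by (simp add: I_def sizes_def)
    subgoal unfolding wp_Skip by (rule Q) (simp_all add: I_def algebra_simps)
    done
qed

lemma wp_find_prev:
  assumes W: "n + 2 \<le> W" and s: "sizes n m l s" "array s ''max'' = (\<lambda>v. if v \<in> M then 1 else 0)"
    and Q: "\<And>t s'. t \<le> n * 60 + 20 \<Longrightarrow> sizes n m l s' \<Longrightarrow>
      (\<forall>v. 0 < v \<longrightarrow> v \<le> n \<longrightarrow> array s' ''prev'' v = prev M v) \<Longrightarrow>
      (\<forall>a. a \<noteq> ''prev'' \<longrightarrow> array s' a = array s a) \<Longrightarrow> Q t s'"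
  shows "wp W find_prev Q s"
proof -
  define I where "I v s' \<longleftrightarrow> sizes n m l s' \<and>
      scalar s' ''v'' = v \<and> scalar s' ''q'' = prev M (Suc v) \<and>
      (\<forall>u. 0 < u \<longrightarrow> u \<le> v \<longrightarrow> array s' ''prev'' u = prev M u) \<and>
      (\<forall>a. a \<noteq> ''prev'' \<longrightarrow> array s' a = array s a)" for v and s' :: state
  have small: "prev M v < W" if "v \<le> Suc n" for v
    using prev_le[of M v] that W by simp
  show ?thesis
    unfolding find_prev_def
    using W
    apply simp
    apply (rule wp_While[where I = I and k = n and T = 50])
    subgoal using s by (simp add: I_def sizes_def)
    subgoal for v r using s W small[of "Suc v"]
      by (auto simp: store_prev_def I_def sizes_def le_Suc_eq)
    subgoal using W by (simp add: I_def sizes_def)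
    subgoal by (simp add: I_def Q)
    done
qed

text \<open>
  The uniqueness assumption is what protects an entry of \<open>mid\<close> from being overwritten by a
  different value in a later round.
\<close>
lemma wp_mark_middles:
  assumes W: "n + 2 \<le> W" "l < W" and s: "sizes n m l s" "array s ''mid'' = (\<lambda>v. 0)"
    and prev: "\<And>v. 0 < v \<Longrightarrow> v \<le> n \<Longrightarrow> array s ''prev'' v = prev M v"
    and XYZ: "array s ''X'' = X" "array s ''Y'' = Y" "array s ''Z'' = Z"
    and bnd: "\<And>i. i < l \<Longrightarrow> 0 < X i \<and> X i < Y i \<and> Y i < Z i \<and> Z i \<le> n"
    and uniq: "\<And>i j. i < l \<Longrightarrow> j < l \<Longrightarrow> Y i < prev M (Z i) \<Longrightarrow> Y j < prev M (Z j) \<Longrightarrow>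
      Y i = Y j \<Longrightarrow> X i = X j"
    and Q: "\<And>t s'. t \<le> l * 60 + 20 \<Longrightarrow> sizes n m l s' \<Longrightarrow>
      (\<forall>i<l. Y i < prev M (Z i) \<longrightarrow> array s' ''mid'' (Y i) = X i) \<Longrightarrow>
      (\<forall>y. array s' ''mid'' y \<noteq> 0 \<longrightarrow>
        (\<exists>i<l. y = Y i \<and> array s' ''mid'' y = X i \<and> Y i < prev M (Z i))) \<Longrightarrow>
      (\<forall>a. a \<noteq> ''mid'' \<longrightarrow> array s' a = array s a) \<Longrightarrow> Q t s'"
  shows "wp W mark_middles Q s"
proof -
  define I where "I k s' \<longleftrightarrow> sizes n m l s' \<and> scalar s' ''k'' = k \<and>
      (\<forall>i<k. Y i < prev M (Z i) \<longrightarrow> array s' ''mid'' (Y i) = X i) \<and>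
      (\<forall>y. array s' ''mid'' y \<noteq> 0 \<longrightarrow>
        (\<exists>i<k. y = Y i \<and> array s' ''mid'' y = X i \<and> Y i < prev M (Z i))) \<and>
      (\<forall>a. a \<noteq> ''mid'' \<longrightarrow> array s' a = array s a)" for k and s' :: state
  have small: "prev M (Z k) < W" if "k < l" for k
    using prev_le[of M "Z k"] bnd[OF that] W by simp
  have body: "bfits W (Less (Var ''k'') (Var ''count'')) r \<and> beval (Less (Var ''k'') (Var ''count'')) r \<and>
      wp W mark_middle (\<lambda>t s'. t \<le> 50 \<and> I (Suc k) s') r"
    if k: "k < l" and I: "I k r" for k r
  proof -
    have parts: "\<forall>i<k. Y i < prev M (Z i) \<longrightarrow> array r ''mid'' (Y i) = X i"
      "\<forall>y. array r ''mid'' y \<noteq> 0 \<longrightarrow>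
        (\<exists>i<k. y = Y i \<and> array r ''mid'' y = X i \<and> Y i < prev M (Z i))"
      "\<forall>a. a \<noteq> ''mid'' \<longrightarrow> array r a = array s a"
      using I unfolding I_def by - (elim conjE, assumption)+
    note old = parts(1)[rule_format] and marked = parts(2)[rule_format]
      and frame = parts(3)[rule_format]
    have r: "array r ''X'' = X" "array r ''Y'' = Y" "array r ''Z'' = Z"
      "array r ''prev'' (Z k) = prev M (Z k)"
      using XYZ prev[of "Z k"] bnd[OF k] frame[of "''X''"] frame[of "''Y''"]
        frame[of "''Z''"] frame[of "''prev''"] by simp_all
    have "sizes n m l r" "scalar r ''k'' = k" using I unfolding I_def by blast+
    then have sz: "scalar r ''n'' = n" "scalar r ''m'' = m" "scalar r ''count'' = l" "scalar r ''k'' = k"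
      by (simp_all add: sizes_def)
    have "X k < Y k" "Y k < Z k" "Z k \<le> n" using bnd[OF k] by simp_all
    then have b: "X k < W" "Y k < W" "Z k < W" "Suc k < W" using W k by linarith+
    show ?thesis
    proof (cases "Y k < prev M (Z k)")
      case True
      let ?mid = "(array r ''mid'')(Y k := X k)"
      have new: "\<forall>i<Suc k. Y i < prev M (Z i) \<longrightarrow> ?mid (Y i) = X i"
      proof (intro allI impI)
        fix i assume i: "i < Suc k" "Y i < prev M (Z i)"
        show "?mid (Y i) = X i"
        proof (cases "Y i = Y k")
          case True
          then have "X i = X k" using i k by (intro uniq) (use \<open>Y k < prev M (Z k)\<close> in auto)
          then show ?thesis using True by simp
        next
          case False
          then have "i < k" using i less_SucE by metis
          then show ?thesis using old[of i] i False by simp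
        qed
      qed
      have "\<exists>i<Suc k. y = Y i \<and> ?mid y = X i \<and> Y i < prev M (Z i)" if "?mid y \<noteq> 0" for y
      proof (cases "y = Y k")
        case False
        then show ?thesis using marked[of y] that by (auto intro: less_SucI)
      qed (use True in auto)
      then have new_back: "\<forall>y. ?mid y \<noteq> 0 \<longrightarrow>
          (\<exists>i<Suc k. y = Y i \<and> ?mid y = X i \<and> Y i < prev M (Z i))"
        by blast
      have "I (Suc k) (r\<lparr>array := (array r)(''mid'' := ?mid),
          scalar := (scalar r)(''k'' := Suc k)\<rparr>)"
        unfolding I_def using new new_back frame sz by (simp add: sizes_def)
      then show ?thesis using True r b sz small[OF k] W(2) k by (simp add: mark_middle_def)
    next
      case False
      have "I (Suc k) (r\<lparr>scalar := (scalar r)(''k'' := Suc k)\<rparr>)"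
        using False old marked frame sz unfolding I_def
        by (auto simp: sizes_def less_Suc_eq)
      then show ?thesis using False r b sz small[OF k] W(2) k by (simp add: mark_middle_def)
    qed
  qed
  show ?thesis
    unfolding mark_middles_def
    using W
    apply simp
    apply (rule wp_While[where I = I and k = l and T = 50])
    subgoal using s by (simp add: I_def sizes_def)
    subgoal for k r using body by simp
    subgoal using W by (simp add: I_def sizes_def)
    subgoal by (simp add: I_def Q)
    done
qed

text \<open>
  The color equations survive later rounds because every color is computed from a smaller
  vertex and written only once.
\<close>
lemma wp_paint:
  assumes W: "n + 2 \<le> W" and s: "sizes n m l s" "array s ''max'' = (\<lambda>v. if v \<in> M then 1 else 0)"
    "array s ''color'' = (\<lambda>v. 0)"
    and prev: "\<And>v. 0 < v \<Longrightarrow> v \<le> n \<Longrightarrow> array s ''prev'' v = prev M v"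
    and mid: "\<And>v. array s ''mid'' v \<noteq> 0 \<Longrightarrow> array s ''mid'' v < v" 
    and Q: "\<And>t s'. t \<le> n * 60 + 20 \<Longrightarrow>
      (\<forall>v. array s' ''color'' v \<le> 1) \<Longrightarrow>
      (\<forall>v. 0 < v \<longrightarrow> v \<le> n \<longrightarrow> array s' ''color'' v =
        (if array s ''mid'' v \<noteq> 0 then 1 - array s' ''color'' (array s ''mid'' v)
         else if v \<in> M then 1 - array s' ''color'' (prev M v)
         else array s' ''color'' (prev M v))) \<Longrightarrow> Q t s'"
  shows "wp W paint Q s"
proof -
  let ?mid = "array s ''mid''"
  define I where "I k s' \<longleftrightarrow> sizes n m l s' \<and> scalar s' ''v'' = k \<and>
      (\<forall>a. a \<noteq> ''color'' \<longrightarrow> array s' a = array s a) \<and>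
      (\<forall>v. array s' ''color'' v \<le> 1) \<and>
      (\<forall>v. 0 < v \<longrightarrow> v \<le> k \<longrightarrow> array s' ''color'' v =
        (if ?mid v \<noteq> 0 then 1 - array s' ''color'' (?mid v)
         else if v \<in> M then 1 - array s' ''color'' (prev M v)
         else array s' ''color'' (prev M v)))" for k and s' :: state
  have body: "bfits W (Less (Var ''v'') (Var ''n'')) r \<and> beval (Less (Var ''v'') (Var ''n'')) r \<and>
     wp W paint_vertex (\<lambda>t s'. t \<le> 50 \<and> I (Suc k) s') r"
    if k: "k < n" and I: "I k r" for k r
  proof -
    have parts: "\<forall>a. a \<noteq> ''color'' \<longrightarrow> array r a = array s a"
      "\<forall>v. array r ''color'' v \<le> 1"
      "\<forall>v. 0 < v \<longrightarrow> v \<le> k \<longrightarrow> array r ''color'' v =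
        (if ?mid v \<noteq> 0 then 1 - array r ''color'' (?mid v)
         else if v \<in> M then 1 - array r ''color'' (prev M v)
         else array r ''color'' (prev M v))"
      "sizes n m l r" "scalar r ''v'' = k"
      using I unfolding I_def by - (elim conjE, assumption)+
    note frame = parts(1)[rule_format] and two = parts(2)[rule_format]
      and old = parts(3)[rule_format]
    have r: "array r ''mid'' = ?mid" "array r ''max'' = (\<lambda>v. if v \<in> M then 1 else 0)"
      "array r ''prev'' (Suc k) = prev M (Suc k)"
      using frame[of "''mid''"] frame[of "''max''"] frame[of "''prev''"] s(2) prev[of "Suc k"] k
      by simp_all
    have sz: "scalar r ''v'' = k" "scalar r ''n'' = n" "scalar r ''m'' = m" "scalar r ''count'' = l"
      using parts(4,5) by (simp_all add: sizes_def)
    have c: "array r ''color'' v < W" for v using two[of v] W by linarith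
    have "?mid v < v" if "0 < v" for v using mid[of v] that by (cases "?mid v = 0") auto
    then have earlier: "prev M v < v" "?mid v < v" if "0 < v" for v
      using prev_less[OF that] that by blast+
    have p: "prev M (Suc k) < W" "?mid (Suc k) < W" "Suc k < W"
      using earlier[of "Suc k"] W k by linarith+
    define x where "x = (if ?mid (Suc k) \<noteq> 0 then 1 - array r ''color'' (?mid (Suc k))
       else if Suc k \<in> M then 1 - array r ''color'' (prev M (Suc k))
       else array r ''color'' (prev M (Suc k)))"
    let ?r' = "r\<lparr>scalar := (scalar r)(''v'' := Suc k),
      array := (array r)(''color'' := (array r ''color'')(Suc k := x))\<rparr>"
    have "x \<le> 1" using two[of "prev M (Suc k)"] by (simp add: x_def)
    moreover have "((array r ''color'')(Suc k := x)) v =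
        (if ?mid v \<noteq> 0 then 1 - ((array r ''color'')(Suc k := x)) (?mid v)
         else if v \<in> M then 1 - ((array r ''color'')(Suc k := x)) (prev M v)
         else ((array r ''color'')(Suc k := x)) (prev M v))" if v: "0 < v" "v \<le> Suc k" for v
    proof -
      have ne: "prev M v \<noteq> Suc k" "?mid v \<noteq> Suc k" using earlier[OF v(1)] v(2) by auto
      show ?thesis
      proof (cases "v = Suc k")
        case True
        with ne show ?thesis by (simp add: x_def)
      next
        case False
        with ne old[OF v(1)] v show ?thesis by simp
      qed
    qed
    ultimately have I': "I (Suc k) ?r'" unfolding I_def using frame two sz by (simp add: sizes_def)
    consider "?mid (Suc k) \<noteq> 0" | "?mid (Suc k) = 0" "Suc k \<in> M" | "?mid (Suc k) = 0" "Suc k \<notin> M"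
      by blast
    then show ?thesis
    proof cases
      case 1
      then show ?thesis using I' r sz c p W k by (simp add: paint_vertex_def x_def)
    next
      case 2
      then show ?thesis using I' r sz c p W k by (simp add: paint_vertex_def x_def)
    next
      case 3
      then show ?thesis using I' r sz c p W k by (simp add: paint_vertex_def x_def)
    qed
  qed
  show ?thesis
    unfolding paint_def
    using W
    apply simp
    apply (rule wp_While[where I = I and k = n and T = 50])
    subgoal using s by (simp add: I_def sizes_def)
    subgoal for k r using body by simp
    subgoal using W by (simp add: I_def sizes_def)
    subgoal by (simp add: I_def Q)
    done
qed

section \<open>Correctness and linear running time of the whole program\<close>

lemma top_three_unique:
  assumes "top_three S x y z" "top_three S a b c" "finite S" "3 \<le> card S" "0 \<notin> S"
  shows "a = x \<and> b = y \<and> c = z"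
proof -
  note p = top_three_proper[OF assms(1,3-5)] and q = top_three_proper[OF assms(2,3-5)]
  have mem: "x \<in> S" "y \<in> S" "z \<in> S" "a \<in> S" "b \<in> S" "c \<in> S" using p(4) q(4) by auto
  have "c = z" using p(2,3) q(2,3) p(5)[OF mem(6)] q(5)[OF mem(3)] by linarith
  moreover have "b = y"
    using p(2,3) q(2,3) p(5)[OF mem(5)] q(5)[OF mem(2)] calculation by linarith
  moreover have "a = x"
    using p(2,3) q(2,3) p(5)[OF mem(4)] q(5)[OF mem(1)] calculation by linarith
  ultimately show ?thesis by simp
qed

lemma lists_hypergraph_uniform:
  assumes H: "special_shift_chain n m H" and es: "lists_hypergraph es H"
  shows "hypergraph_size n H = n + length es * m"
    and "e \<in> set es \<Longrightarrow> distinct e \<and> length e = m \<and> set e \<subseteq> {1..n}"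
proof -
  have unif: "A \<subseteq> {1..n} \<and> card A = m" if "A \<in> H" for A
    using H that unfolding special_shift_chain_def shift_chain_def uniform_hypergraph_def by blast
  have "card H = length es"
    using es distinct_card[of "map set es"] unfolding lists_hypergraph_def by simp
  moreover have "(\<Sum>A\<in>H. card A) = (\<Sum>A\<in>H. m)" using unif by (intro sum.cong) auto
  ultimately show "hypergraph_size n H = n + length es * m" by (simp add: hypergraph_size_def)
  assume e: "e \<in> set es"
  then have "distinct e" "set e \<in> H" using es by (auto simp: lists_hypergraph_def)
  then show "distinct e \<and> length e = m \<and> set e \<subseteq> {1..n}"
    using unif[of "set e"] distinct_card[of e] by simp
qed

lemma wp_color_special_shift_chain:
  assumes m: "3 \<le> m" and H: "special_shift_chain n m H" and es: "lists_hypergraph es H"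
    and W: "hypergraph_size n H + 2 \<le> W"
  shows "wp W color_special_shift_chain
    (\<lambda>t s. t \<le> 1000 * (hypergraph_size n H + 1) \<and> proper_2_coloring n H (output_coloring s))
    (input_state n m es)"
proof -
  let ?T = "\<lambda>a b c. \<exists>A\<in>H. top_three A a b c" and ?l = "length es"
  interpret triple_chain ?T n using H m by (rule triple_chain_top_three)
  note size = lists_hypergraph_uniform(1)[OF H es]
  have edge: "distinct e \<and> length e = m \<and> 3 \<le> m \<and> set e \<subseteq> {1..n}" if "e \<in> set es" for e
    using lists_hypergraph_uniform(2)[OF H es that] m by simp
  \<comment> \<open>the number of hyperedges is at most their total size, which absorbs the constant costs per edge\<close>
  have "?l * 1 \<le> ?l * m" using m by (intro mult_le_mono2) simp
  then have l: "?l \<le> ?l * m" by simp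
  have W': "n + 2 \<le> W" "?l * m + 2 \<le> W" "?l < W" using W l unfolding size by linarith+
  have H_es: "H = set ` set es" using es by (auto simp: lists_hypergraph_def)
  show ?thesis
    unfolding color_special_shift_chain_def block.simps
  proof (rule wp_Seq[THEN iffD2], rule wp_read_edges[OF edge W'(1,2)], assumption)
    fix t1 and s1 :: state
    let ?X = "array s1 ''X''" and ?Y = "array s1 ''Y''" and ?Z = "array s1 ''Z''"
    assume t1: "t1 \<le> ?l * (100 * m + 200) + 20" and sizes1: "sizes n m ?l s1"
      and top: "\<forall>i<?l. top_three (set (es ! i)) (?X i) (?Y i) (?Z i)"
      and max1: "array s1 ''max'' = (\<lambda>v. if v \<in> ?Z ` {..<?l} then 1 else 0)"
      and mid1: "array s1 ''mid'' = (\<lambda>v. 0)" and color1: "array s1 ''color'' = (\<lambda>v. 0)"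
    have T_iff: "?T a b c \<longleftrightarrow> (\<exists>i<?l. a = ?X i \<and> b = ?Y i \<and> c = ?Z i)" for a b c
    proof
      assume "?T a b c"
      then obtain i where i: "i < ?l" "top_three (set (es ! i)) a b c"
        unfolding H_es by (auto simp: in_set_conv_nth)
      have "distinct (es ! i)" "length (es ! i) = m" "set (es ! i) \<subseteq> {1..n}"
        using edge[of "es ! i"] i(1) by simp_all
      then have "3 \<le> card (set (es ! i))" "0 \<notin> set (es ! i)" using m by (auto simp: distinct_card)
      moreover have "top_three (set (es ! i)) (?X i) (?Y i) (?Z i)" using top i(1) by blast
      ultimately have "a = ?X i \<and> b = ?Y i \<and> c = ?Z i"
        using top_three_unique[OF _ i(2) finite_set] by blast
      then show "\<exists>i<?l. a = ?X i \<and> b = ?Y i \<and> c = ?Z i" using i(1) by blast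
    next
      assume "\<exists>i<?l. a = ?X i \<and> b = ?Y i \<and> c = ?Z i"
      then obtain i where "i < ?l" "a = ?X i" "b = ?Y i" "c = ?Z i" by blast
      then show "?T a b c" using top unfolding H_es by (intro bexI[of _ "set (es ! i)"]) simp_all
    qed
    have T: "?T (?X i) (?Y i) (?Z i)" if "i < ?l" for i using T_iff that by blast
    have maxima: "?Z ` {..<?l} = maxima" unfolding maxima_def unfolding T_iff by blast
    have bounds: "0 < ?X i \<and> ?X i < ?Y i \<and> ?Y i < ?Z i \<and> ?Z i \<le> n" if "i < ?l" for i
      using incr[OF T[OF that]] .
    have loose: "loose (?X i) (?Y i) (?Z i)" if "i < ?l" "?Y i < prev maxima (?Z i)" for i
      unfolding loose_def using T[OF that(1)] that(2) by blast
    show "wp W (Seq find_prev (Seq mark_middles (Seq paint Skip))) (\<lambda>t2 s.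
        1 + t1 + t2 \<le> 1000 * (hypergraph_size n H + 1) \<and>
        proper_2_coloring n H (output_coloring s)) s1"
    proof (rule wp_Seq[THEN iffD2], rule wp_find_prev[OF W'(1) sizes1 max1, unfolded maxima])
      fix t2 and s2 :: state
      assume t2: "t2 \<le> n * 60 + 20" and sizes2: "sizes n m ?l s2"
        and prev2: "\<forall>v. 0 < v \<longrightarrow> v \<le> n \<longrightarrow> array s2 ''prev'' v = prev maxima v"
        and frame2: "\<forall>a. a \<noteq> ''prev'' \<longrightarrow> array s2 a = array s1 a"
      have arrays2: "array s2 ''mid'' = (\<lambda>v. 0)" "array s2 ''X'' = ?X" "array s2 ''Y'' = ?Y"
        "array s2 ''Z'' = ?Z" using frame2 mid1 by simp_all
      show "wp W (Seq mark_middles (Seq paint Skip)) (\<lambda>t3 s.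
        1 + t1 + (1 + t2 + t3) \<le> 1000 * (hypergraph_size n H + 1) \<and>
        proper_2_coloring n H (output_coloring s)) s2"
      proof (rule wp_Seq[THEN iffD2],
          rule wp_mark_middles[OF W'(1,3) sizes2 arrays2(1) _ arrays2(2-4) bounds])
        show "array s2 ''prev'' v = prev maxima v" if "0 < v" "v \<le> n" for v
          using prev2 that by simp
        show "?X i = ?X j" if "i < ?l" "j < ?l" "?Y i < prev maxima (?Z i)"
          "?Y j < prev maxima (?Z j)" "?Y i = ?Y j" for i j
          using loose_unique[OF loose[OF that(2,4)], of "?X i" "?Z i"] loose[OF that(1,3)] that(5)
          by simp
        fix t3 and s3 :: state
        let ?mid = "array s3 ''mid''"
        assume t3: "t3 \<le> ?l * 60 + 20" and sizes3: "sizes n m ?l s3"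
          and mid3: "\<forall>i<?l. ?Y i < prev maxima (?Z i) \<longrightarrow> ?mid (?Y i) = ?X i"
          and loose3: "\<forall>y. ?mid y \<noteq> 0 \<longrightarrow>
            (\<exists>i<?l. y = ?Y i \<and> ?mid y = ?X i \<and> ?Y i < prev maxima (?Z i))"
          and frame3: "\<forall>a. a \<noteq> ''mid'' \<longrightarrow> array s3 a = array s2 a"
        have arrays3: "array s3 ''max'' = (\<lambda>v. if v \<in> maxima then 1 else 0)"
          "array s3 ''color'' = (\<lambda>v. 0)"
          using frame2 frame3 color1 max1 maxima by simp_all
        have loose_mid: "\<exists>t. loose (?mid y) y t" if "?mid y \<noteq> 0" for y
        proof -
          obtain i where i: "i < ?l" "y = ?Y i" "?mid y = ?X i" "?Y i < prev maxima (?Z i)"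
            using loose3 \<open>?mid y \<noteq> 0\<close> by blast
          have "loose (?mid y) y (?Z i)" unfolding i(3) unfolding i(2) using i(1,4) by (rule loose)
          then show ?thesis by blast
        qed
        have mid: "?mid y = x" if "loose x y t" for x y t
        proof -
          have t: "?T x y t" "y < prev maxima t" using that unfolding loose_def by blast+
          obtain i where "i < ?l" "x = ?X i" "y = ?Y i" "t = ?Z i" using t(1) T_iff by blast
          then show ?thesis using mid3 t(2) by blast
        qed
        show "wp W (Seq paint Skip) (\<lambda>t4 s.
          1 + t1 + (1 + t2 + (1 + t3 + t4)) \<le> 1000 * (hypergraph_size n H + 1) \<and>
          proper_2_coloring n H (output_coloring s)) s3"
        proof (rule wp_Seq[THEN iffD2], rule wp_paint[OF W'(1) sizes3 arrays3])
          show "array s3 ''prev'' v = prev maxima v" if "0 < v" "v \<le> n" for v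
            using prev2 frame3 that by simp
          show "?mid v < v" if marked: "?mid v \<noteq> 0" for v
          proof -
            obtain t where "loose (?mid v) v t" using loose_mid[OF marked] by blast
            then show ?thesis using incr[of "?mid v" v t] unfolding loose_def by blast
          qed
          fix t4 and s4 :: state
          let ?f = "array s4 ''color''"
          assume t4: "t4 \<le> n * 60 + 20" and two: "\<forall>v. ?f v \<le> 1"
            and col: "\<forall>v. 0 < v \<longrightarrow> v \<le> n \<longrightarrow> ?f v =
              (if ?mid v \<noteq> 0 then 1 - ?f (?mid v)
               else if v \<in> maxima then 1 - ?f (prev maxima v) else ?f (prev maxima v))"
          have "\<not> monochromatic ?f A" if A: "A \<in> H" for A
          proof -
            obtain i where i: "i < ?l" "A = set (es ! i)"
              using A unfolding H_es by (auto simp: in_set_conv_nth)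
            have "top_three A (?X i) (?Y i) (?Z i)" using top[rule_format, OF i(1)] i(2) by simp
            then have "{?X i, ?Y i, ?Z i} \<subseteq> insert 0 A" by (simp add: top_three_def)
            then have "{?X i, ?Y i, ?Z i} \<subseteq> A"
              using bounds[OF i(1)] by auto
            moreover have "?f (?X i) \<noteq> ?f (?Y i) \<or> ?f (?Y i) \<noteq> ?f (?Z i)"
              by (rule not_monochromatic[of ?mid ?f, OF mid loose_mid
                col[rule_format] two[rule_format] T[OF i(1)]])
            ultimately show ?thesis unfolding monochromatic_def by blast
          qed
          moreover have "?f v \<in> {0, 1}" for v
            using two[rule_format, of v] by (cases "?f v") auto
          ultimately have "proper_2_coloring n H (output_coloring s4)"
            unfolding proper_2_coloring_def output_coloring_def[abs_def] by blast
          moreover have "1 + t1 + (1 + t2 + (1 + t3 + (1 + t4 + 1))) \<le> 1000 * (hypergraph_size n H + 1)"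
          proof -
            define p where "p = ?l * m"
            have "t1 \<le> 100 * p + 200 * ?l + 20" using t1 by (simp add: p_def algebra_simps)
            moreover have "?l \<le> p" using l by (simp only: p_def)
            ultimately have "1 + t1 + (1 + t2 + (1 + t3 + (1 + t4 + 1))) \<le> 360 * p + 120 * n + 200"
              using t2 t3 t4 by linarith
            then show ?thesis using size by (simp add: p_def)
          qed
          ultimately show "wp W Skip (\<lambda>t5 s.
              1 + t1 + (1 + t2 + (1 + t3 + (1 + t4 + t5))) \<le> 1000 * (hypergraph_size n H + 1) \<and>
              proper_2_coloring n H (output_coloring s)) s4"
            unfolding wp_Skip by blast
        qed
      qed
    qed
  qed
qed

lemma linear_time_coloring:
  "colors_special_shift_chains_in_linear_time color_special_shift_chain 3"
  unfolding colors_special_shift_chains_in_linear_time_def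
\<comment> \<open>a generous bound for the cost per vertex and per hyperedge element; as exponent, 1 would do\<close>
proof (rule exI[of _ 1000], intro allI impI)
  fix m n H es
  assume *: "3 \<le> m" "special_shift_chain n m H" "lists_hypergraph es H"
  let ?N = "hypergraph_size n H"
  have "(?N + 2) ^ 1 \<le> (?N + 2) ^ 1000" by (rule power_increasing) simp_all
  then have "?N + 2 \<le> (?N + 2) ^ 1000" by (simp only: power_one_right)
  from wp_color_special_shift_chain[OF * this]
  show "\<exists>t s. exec ((?N + 2) ^ 1000) color_special_shift_chain (input_state n m es) t s \<and>
      t \<le> 1000 * (?N + 1) \<and> proper_2_coloring n H (output_coloring s)"
    unfolding wp_def by blast
qed

text \<open>
  Connects the existence of a coloring to the program, which works on listed hypergraphs.
\<close>
lemma finite_hypergraph_listing: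
  assumes "finite H" "\<And>A. A \<in> H \<Longrightarrow> finite A"
  obtains es where "lists_hypergraph es H"
proof -
  obtain As where As: "set As = H" "distinct As" using finite_distinct_list[OF assms(1)] by blast
  have "map set (map sorted_list_of_set As) = As" using As assms(2) by (auto intro!: map_idI)
  moreover have "set (map set (map sorted_list_of_set As)) = H" using calculation As by simp
  ultimately have "lists_hypergraph (map sorted_list_of_set As) H"
    unfolding lists_hypergraph_def using As by simp
  then show thesis by (rule that)
qed

theorem theorem6p3:
  "(\<forall>m n H. m \<ge> 3 \<longrightarrow> special_shift_chain n m H \<longrightarrow> two_colorable n H) \<and>
   (\<exists>P. colors_special_shift_chains_in_linear_time P 3)"
proof (intro conjI allI impI exI)
  fix m n H assume m: "3 \<le> m" and H: "special_shift_chain n m H"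
  have sub: "A \<subseteq> {1..n}" if "A \<in> H" for A
    using H that unfolding special_shift_chain_def shift_chain_def uniform_hypergraph_def by blast
  then have "H \<subseteq> Pow {1..n}" by blast
  then have "finite H" by (rule finite_subset) simp
  moreover have "finite A" if "A \<in> H" for A using sub[OF that] by (rule finite_subset) simp
  ultimately obtain es where es: "lists_hypergraph es H" by (rule finite_hypergraph_listing)
  then show "two_colorable n H"
    using linear_time_coloring m H
    unfolding colors_special_shift_chains_in_linear_time_def two_colorable_def by blast
next
  show "colors_special_shift_chains_in_linear_time color_special_shift_chain 3"
    by (rule linear_time_coloring)
qed

end
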